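(* Let $D$ be an oriented knot diagram on $S^2$ with $c\ge 1$ crossings $v_1,\dots,v_c$, and for each $i$ let $D^i$ be the diagram obtained from $D$ by a crossing change at $v_i$. Then the $c+1$ knot diagrams $D, D^1, D^2,\dots,D^c$ (that is, $D$ together with all the $c$ diagrams obtained from $D$ by a single crossing change) are linearly independent.
   Context: An oriented knot projection $P$ on $S^2$ is a generic immersion of an oriented circle in $S^2$ (its only singularities are finitely many transverse double points, called crossings). An oriented knot diagram $D$ on $S^2$ is an oriented knot projection with over/under information at each crossing; a crossing change at a crossing switches the over/under information there. For a base point $b$ of $D$ avoiding crossings, a crossing $p$ is a warping crossing point of $D_b=(D,b)$ if, when traveling along $D$ from $b$ following the orientation, one meets $p$ first as an undercrossing. The warping degree $d(D_b)$ is the number of warping crossing points of $D_b$. Let $P$ be an oriented knot projection with $c$ crossings. An edge of $P$ is a part of $P$ between two (consecutive) crossings with no crossing in its interior; $P$ has $2c$ edges. Take one base point on each edge and label them $b_1,\dots,b_{2c}$ in order of traversal, starting from some edge. Giving over/under information at each crossing of $P$ in all possible ways yields $2^c$ knot diagrams. The warping matrix $M(P)$ is the $2^c\times 2c$ matrix with one row for each of these diagrams $E$, whose row for $E$ is $(d(E_{b_1}),\dots,d(E_{b_{2c}}))$. Knot diagrams obtained from the same knot projection $P$ are called linearly independent if the corresponding rows of $M(P)$ are linearly independent (over $\mathbb{Q}$, equivalently $\mathbb{R}$). *)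

theory Defs
  imports "Jordan_Normal_Form.VS_Connect" "HOL-Analysis.Analysis"
begin

(* The oriented circle is the unit circle of the complex plane with its counterclockwise
   orientation, and S^2 is the unit sphere of real^3.  A knot projection is represented by its
   parametrization f; only the values of f on the unit circle are ever used.  Base points,
   edges and strands are taken in the domain of f, where the two branches passing through a
   crossing are different points. *)

abbreviation circle :: "complex set" where
  "circle \<equiv> sphere 0 1"

(* velocity of the curve at the parameter z, in the direction of the orientation *)
definition velocity :: "(complex \<Rightarrow> real ^ 3) \<Rightarrow> complex \<Rightarrow> real ^ 3" where
  "velocity f z = vector_derivative (\<lambda>t. f (z * cis t)) (at 0)"

(* No smoothness beyond C^1 is required, so C-infinity immersions are included. *)
definition immersion_S2 :: "(complex \<Rightarrow> real ^ 3) \<Rightarrow> bool" where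
  "immersion_S2 f \<longleftrightarrow>
     f ` circle \<subseteq> sphere 0 1 \<and>
     (\<lambda>t. f (cis t)) C1_differentiable_on UNIV \<and>
     (\<forall>z\<in>circle. velocity f z \<noteq> 0)"

definition strands :: "(complex \<Rightarrow> real ^ 3) \<Rightarrow> real ^ 3 \<Rightarrow> complex set" where
  "strands f p = {z \<in> circle. f z = p}"

definition crossings :: "(complex \<Rightarrow> real ^ 3) \<Rightarrow> (real ^ 3) set" where
  "crossings f = {p. \<exists>z\<in>strands f p. \<exists>w\<in>strands f p. z \<noteq> w}"

(* Transversality at p: the two velocities span the tangent plane of the sphere at p, which is
   the orthogonal complement of p. *)
definition knot_projection :: "(complex \<Rightarrow> real ^ 3) \<Rightarrow> bool" where
  "knot_projection f \<longleftrightarrow>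
     immersion_S2 f \<and>
     finite (crossings f) \<and>
     (\<forall>p\<in>crossings f. card (strands f p) = 2 \<and>
        span (velocity f ` strands f p) = {x. orthogonal p x})"

(* Over/under information assigns to every crossing its over strand. The functions are
   extensional, so a projection with c crossings carries exactly 2^c of them. *)
type_synonym crossing_info = "real ^ 3 \<Rightarrow> complex"

definition diagrams :: "(complex \<Rightarrow> real ^ 3) \<Rightarrow> crossing_info set" where
  "diagrams f = (\<Pi>\<^sub>E p\<in>crossings f. strands f p)"

definition knot_diagram :: "(complex \<Rightarrow> real ^ 3) \<Rightarrow> crossing_info \<Rightarrow> bool" where
  "knot_diagram f E \<longleftrightarrow> knot_projection f \<and> E \<in> diagrams f"

definition under_strand :: "(complex \<Rightarrow> real ^ 3) \<Rightarrow> crossing_info \<Rightarrow> real ^ 3 \<Rightarrow> complex" where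
  "under_strand f E p = the_elem (strands f p - {E p})"

definition crossing_change ::
  "(complex \<Rightarrow> real ^ 3) \<Rightarrow> crossing_info \<Rightarrow> real ^ 3 \<Rightarrow> crossing_info" where
  "crossing_change f E p = E(p := under_strand f E p)"

(* time in [0, 2 pi) needed to travel counterclockwise at unit speed from b to z *)
definition travel_time :: "complex \<Rightarrow> complex \<Rightarrow> real" where
  "travel_time b z = Arg2pi (z / b)"

definition warping_crossing ::
  "(complex \<Rightarrow> real ^ 3) \<Rightarrow> crossing_info \<Rightarrow> complex \<Rightarrow> real ^ 3 \<Rightarrow> bool" where
  "warping_crossing f E b p \<longleftrightarrow>
     p \<in> crossings f \<and> travel_time b (under_strand f E p) < travel_time b (E p)"

definition warping_degree ::
  "(complex \<Rightarrow> real ^ 3) \<Rightarrow> crossing_info \<Rightarrow> complex \<Rightarrow> nat" where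
  "warping_degree f E b = card {p. warping_crossing f E b p}"

(* For a projection with at least one crossing these are the open arcs between
   consecutive crossings. *)
definition edges :: "(complex \<Rightarrow> real ^ 3) \<Rightarrow> complex set set" where
  "edges f = components (circle - (\<Union>p\<in>crossings f. strands f p))"

(* one base point on each of the 2c edges, listed in the order of traversal from the first *)
definition base_points :: "(complex \<Rightarrow> real ^ 3) \<Rightarrow> complex list \<Rightarrow> bool" where
  "base_points f bs \<longleftrightarrow>
     length bs = 2 * card (crossings f) \<and>
     set bs \<subseteq> \<Union>(edges f) \<and>
     (\<forall>e\<in>edges f. \<exists>!j. j < length bs \<and> bs ! j \<in> e) \<and>
     sorted_wrt (<) (map (travel_time (hd bs)) bs)"

(* an ordering of all diagrams with the given projection, fixing the order of the rows *)
definition enumerates_diagrams ::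
  "(complex \<Rightarrow> real ^ 3) \<Rightarrow> crossing_info list \<Rightarrow> bool" where
  "enumerates_diagrams f Es \<longleftrightarrow> distinct Es \<and> set Es = diagrams f"

definition warping_matrix ::
  "(complex \<Rightarrow> real ^ 3) \<Rightarrow> crossing_info list \<Rightarrow> complex list \<Rightarrow> real mat" where
  "warping_matrix f Es bs =
     Matrix.mat (2 ^ card (crossings f)) (2 * card (crossings f))
       (\<lambda>(i, j). real (warping_degree f (Es ! i) (bs ! j)))"

definition diagram_row ::
  "(complex \<Rightarrow> real ^ 3) \<Rightarrow> crossing_info list \<Rightarrow> complex list \<Rightarrow> crossing_info \<Rightarrow> real Matrix.vec" where
  "diagram_row f Es bs E =
     Matrix.row (warping_matrix f Es bs) (THE i. i < length Es \<and> Es ! i = E)"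

(* Linear independence of the family of rows: the library notion is about sets of vectors,
   hence the additional requirement that no row is repeated. *)
definition linearly_independent_diagrams ::
  "(complex \<Rightarrow> real ^ 3) \<Rightarrow> crossing_info list \<Rightarrow> complex list \<Rightarrow> crossing_info list \<Rightarrow> bool" where
  "linearly_independent_diagrams f Es bs Ds \<longleftrightarrow>
     (let rs = map (diagram_row f Es bs) Ds in
        distinct rs \<and>
        LinearCombinations.module.lin_indpt class_ring
          (module_vec TYPE(real) (2 * card (crossings f))) (set rs))"

end

theory Submission
  imports Defs
begin

text \<open>Let \<open>w\<^sub>p\<close> be the indicator, as a function of the base point, of \<open>p\<close> being a warping crossing of
  \<open>D\<close>. The row of \<open>D\<close> is \<open>\<Sum>\<^sub>p w\<^sub>p\<close>, and changing the crossing \<open>p\<close> adds \<open>1 - 2w\<^sub>p\<close> to it. A relation with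
  coefficients \<open>a\<close> (for \<open>D\<close>) and \<open>\<alpha>\<^sub>p\<close> therefore reads \<open>\<Sum>\<^sub>p (A - 2\<alpha>\<^sub>p) w\<^sub>p + \<Sum>\<^sub>p \<alpha>\<^sub>p = 0\<close> with
  \<open>A = a + \<Sum>\<^sub>p \<alpha>\<^sub>p\<close>. Each \<open>w\<^sub>q\<close> is constant on edges, and passing a strand of \<open>p\<close> changes \<open>w\<^sub>p\<close> only,
  so \<open>A = 2\<alpha>\<^sub>p\<close> for every \<open>p\<close>; then \<open>\<Sum>\<^sub>p \<alpha>\<^sub>p = 0\<close>, which forces \<open>A\<close> and all coefficients to vanish.\<close>

unbundle no vec_syntax

section \<open>Linear independence of indexed families\<close>

text \<open>Relations are indexed by \<open>I\<close> rather than by the set of vectors, so a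
  repetition among the \<open>g i\<close> would itself be a nontrivial relation. One hypothesis thus
  yields both conditions in \<open>linearly_independent_diagrams\<close>.\<close>

lemma inj_on_lin_indpt_image:
  fixes g :: "'i \<Rightarrow> real Matrix.vec"
  assumes finite_I: "finite I" and carr: "\<And>i. i \<in> I \<Longrightarrow> g i \<in> carrier_vec n"
    and indep: "\<And>a. (\<And>j. j < n \<Longrightarrow> (\<Sum>i\<in>I. a i * g i $ j) = 0) \<Longrightarrow> \<forall>i\<in>I. a i = 0"
  shows "inj_on g I"
    and "LinearCombinations.module.lin_indpt class_ring (module_vec TYPE(real) n) (g ` I)"
proof -
  show inj: "inj_on g I"
  proof (rule inj_onI, rule ccontr)
    fix i k assume ik: "i \<in> I" "k \<in> I" "g i = g k" "i \<noteq> k"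
    \<comment> \<open>Coefficient 1 at \<open>i\<close> and -1 at \<open>k\<close>: the relation
      expressing \<open>g i = g k\<close>.\<close>
    define a where "a x = (if x = i then 1 else 0) - (if x = k then 1 else (0::real))" for x
    have "(\<Sum>x\<in>I. a x * g x $ j) = 0" for j
      using finite_I ik by (simp add: a_def left_diff_distrib sum_subtractf if_distrib[of "\<lambda>x. x * _"] cong: if_cong)
    then have "a i = 0" using indep ik by blast
    then show False using ik by (simp add: a_def)
  qed
  interpret vec_space "TYPE(real)" n .
  show "lin_indpt (g ` I)"
  proof (rule finite_lin_indpt2)
    show "finite (g ` I)" using finite_I by simp
    show sub: "g ` I \<subseteq> carrier_vec n" using carr by blast
    fix a :: "real Matrix.vec \<Rightarrow> real"
    assume "lincomb a (g ` I) = 0\<^sub>v n"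
    then have "(\<Sum>i\<in>I. a (g i) * g i $ j) = 0" if "j < n" for j
      using lincomb_index[OF that sub, of a] that by (simp add: sum.reindex[OF inj])
    then have "\<forall>i\<in>I. a (g i) = 0" by (rule indep)
    then show "\<forall>v\<in>g ` I. a v = 0" by simp
  qed
qed

section \<open>Travel times on the circle\<close>

lemma travel_time_eqI:
  assumes "norm b = 1" "z = b * cis t" "0 \<le> t" "t < 2 * pi"
  shows "travel_time b z = t"
  unfolding travel_time_def
proof (rule Arg2pi_unique)
  have "b \<noteq> 0" using assms(1) by auto
  then show "complex_of_real 1 * exp (\<i> * complex_of_real t) = z / b"
    using assms(2) by (simp add: cis_conv_exp)
qed (use assms in auto)

lemma travel_time_bounds: "0 \<le> travel_time b z" "travel_time b z < 2 * pi"
  by (simp_all add: travel_time_def Arg2pi_ge_0 Arg2pi_lt_2pi)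

lemma cis_travel_time:
  assumes "norm b = 1" "norm z = 1"
  shows "b * cis (travel_time b z) = z"
proof -
  have "norm (z / b) = 1" using assms by (simp add: norm_divide)
  then have "cis (travel_time b z) = z / b"
    unfolding travel_time_def cis_conv_exp using complex_norm_eq_1_exp by blast
  moreover have "b \<noteq> 0" using assms(1) by auto
  ultimately show ?thesis by simp
qed

lemma travel_time_inj:
  assumes "norm b = 1" "norm z = 1" "norm w = 1" "travel_time b z = travel_time b w"
  shows "z = w"
  using assms cis_travel_time by metis

lemma travel_time_pos:
  assumes "norm b = 1" "norm z = 1" "z \<noteq> b"
  shows "0 < travel_time b z"
  using assms cis_travel_time[of b z] travel_time_bounds(1)[of b z]
  by (cases "travel_time b z = 0") auto

text \<open>\<open>Arg2pi\<close> is continuous off the nonnegative real axis, and the unit number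
  \<open>z / b\<close> meets that axis only at 1, that is, for \<open>b = z\<close>.\<close>

lemma continuous_on_travel_time:
  "continuous_on (circle - {z}) (\<lambda>b. travel_time b z)" if "norm z = 1"
proof (rule continuous_at_imp_continuous_on, rule ballI)
  fix b assume b: "b \<in> circle - {z}"
  then have b0: "b \<noteq> 0" by auto
  have "z / b \<notin> \<real>\<^sub>\<ge>\<^sub>0"
  proof
    assume "z / b \<in> \<real>\<^sub>\<ge>\<^sub>0"
    then obtain r where r: "z / b = of_real r" "0 \<le> r" by (auto elim: nonneg_Reals_cases)
    have "norm (z / b) = 1" using that b by (simp add: norm_divide)
    then have "r = 1" using r by simp
    then show False using r b b0 by simp
  qed
  then show "isCont (\<lambda>b. travel_time b z) b"
    unfolding travel_time_def
    using b0 by (intro isCont_o2[OF _ continuous_at_Arg2pi]) auto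
qed

section \<open>Crossing changes and their effect on the warping degree\<close>

lemma strands_eq:
  assumes "knot_projection f" "E \<in> diagrams f" "p \<in> crossings f"
  shows "strands f p = {E p, under_strand f E p}" "E p \<noteq> under_strand f E p"
proof -
  have "card (strands f p) = 2" "E p \<in> strands f p"
    using assms by (auto simp: knot_projection_def diagrams_def)
  then obtain u where u: "strands f p = {E p, u}" "u \<noteq> E p"
    by (metis (no_types, opaque_lifting) card_2_iff doubleton_eq_iff insertE singletonD)
  then have "strands f p - {E p} = {u}" by auto
  then have "under_strand f E p = u" by (simp add: under_strand_def)
  with u show "strands f p = {E p, under_strand f E p}" "E p \<noteq> under_strand f E p" by auto
qed

lemma crossing_change_in_diagrams:
  assumes "knot_projection f" "E \<in> diagrams f" "p \<in> crossings f"
  shows "crossing_change f E p \<in> diagrams f"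
  using assms strands_eq[OF assms]
  by (auto simp: crossing_change_def diagrams_def PiE_iff extensional_def)

lemma under_strand_crossing_change:
  assumes "knot_projection f" "E \<in> diagrams f" "p \<in> crossings f"
  shows "under_strand f (crossing_change f E p) q = (if q = p then E p else under_strand f E q)"
proof -
  have "strands f p - {under_strand f E p} = {E p}" using strands_eq[OF assms] by auto
  then show ?thesis by (simp add: under_strand_def crossing_change_def)
qed

lemma crossing_change_neq:
  assumes "knot_projection f" "E \<in> diagrams f" "p \<in> crossings f"
  shows "crossing_change f E p \<noteq> E"
  using strands_eq(2)[OF assms] by (metis crossing_change_def fun_upd_same)

text \<open>The diagram changed at \<open>p\<close> differs from \<open>E\<close> at
  \<open>p\<close>, while one changed at another crossing agrees with \<open>E\<close>
  there.\<close>

lemma inj_on_crossing_change: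
  assumes "knot_projection f" "E \<in> diagrams f"
  shows "inj_on (crossing_change f E) (crossings f)"
  using strands_eq(2)[OF assms] by (intro inj_onI) (metis crossing_change_def fun_upd_apply)

text \<open>The two strands of \<open>p\<close> are distinct points of the circle, so their travel
  times never tie, and swapping them negates the strict comparison.\<close>

lemma warping_crossing_change:
  assumes "knot_projection f" "E \<in> diagrams f" "p \<in> crossings f" and b: "b \<in> circle"
  shows "warping_crossing f (crossing_change f E p) b q \<longleftrightarrow>
    (if q = p then \<not> warping_crossing f E b p else warping_crossing f E b q)"
proof -
  have "norm (E p) = 1" "norm (under_strand f E p) = 1"
    using strands_eq(1)[OF assms(1-3)] by (auto simp: strands_def set_eq_iff)
  then have "travel_time b (E p) \<noteq> travel_time b (under_strand f E p)"
    using travel_time_inj strands_eq(2)[OF assms(1-3)] b by (metis mem_sphere_0)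
  then show ?thesis
    using assms by (auto simp: warping_crossing_def under_strand_crossing_change)
      (auto simp: crossing_change_def)
qed

lemma warping_degree_eq_sum:
  assumes "finite (crossings f)"
  shows "real (warping_degree f E b) = (\<Sum>p\<in>crossings f. of_bool (warping_crossing f E b p))"
proof -
  have "{p. warping_crossing f E b p} = crossings f \<inter> {p. warping_crossing f E b p}"
    by (auto simp: warping_crossing_def)
  then show ?thesis using assms by (simp add: warping_degree_def)
qed

lemma warping_degree_crossing_change:
  assumes "knot_projection f" "E \<in> diagrams f" "p \<in> crossings f" and b: "b \<in> circle"
  shows "real (warping_degree f (crossing_change f E p) b) =
    real (warping_degree f E b) + 1 - 2 * of_bool (warping_crossing f E b p)"
proof -
  have fin: "finite (crossings f)" using assms by (simp add: knot_projection_def)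
  have "(\<Sum>q\<in>crossings f - {p}. of_bool (warping_crossing f (crossing_change f E p) b q) :: real) =
      (\<Sum>q\<in>crossings f - {p}. of_bool (warping_crossing f E b q))"
    by (rule sum.cong) (auto simp: warping_crossing_change[OF assms])
  then show ?thesis
    using warping_crossing_change[OF assms, of p]
    by (simp add: warping_degree_eq_sum[OF fin] sum.remove[OF fin assms(3)])
qed

section \<open>Dependence on the base point\<close>

text \<open>The difference of the travel times to the two strands of \<open>q\<close> is continuous
  on \<open>C\<close> and never 0, so it keeps its sign on a connected set.\<close>

lemma warping_crossing_constant:
  assumes "knot_projection f" "E \<in> diagrams f"
    and "connected C" "C \<subseteq> circle - (\<Union>p\<in>crossings f. strands f p)" "b \<in> C" "b' \<in> C"
  shows "warping_crossing f E b q \<longleftrightarrow> warping_crossing f E b' q"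
proof (cases "q \<in> crossings f")
  case True
  let ?u = "under_strand f E q" and ?o = "E q"
  note st = strands_eq[OF assms(1,2) True]
  have n: "norm ?u = 1" "norm ?o = 1"
    using st(1) by (auto simp: strands_def set_eq_iff)
  have C: "C \<subseteq> circle" "?u \<notin> C" "?o \<notin> C" using assms(4) st True by auto
  define h where "h b = travel_time b ?u - travel_time b ?o" for b
  have "continuous_on C h"
    unfolding h_def using C n
    by (intro continuous_on_diff continuous_on_subset[OF continuous_on_travel_time]) auto
  then have "connected (h ` C)" using assms(3) by (rule connected_continuous_image)
  moreover have "0 \<notin> h ` C"
    using travel_time_inj n st(2) C(1) by (fastforce simp: h_def)
  ultimately have "h b < 0 \<longleftrightarrow> h b' < 0"
    using assms(5,6) connectedD_interval[of "h ` C" _ _ 0]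
    by (metis image_eqI linorder_neqE_linordered_idom order_less_imp_le)
  then show ?thesis using True by (simp add: warping_crossing_def h_def)
qed (simp add: warping_crossing_def)

text \<open>Moving the base point across a strand of \<open>p\<close> moves that strand from the front to the back of
  the itinerary and shifts the travel times to all other strands equally.\<close>

lemma warping_crossing_jump:
  assumes "knot_projection f" "E \<in> diagrams f" "p \<in> crossings f"
  obtains b b' where "b \<in> circle - (\<Union>p\<in>crossings f. strands f p)"
    "b' \<in> circle - (\<Union>p\<in>crossings f. strands f p)"
    "\<not> warping_crossing f E b p" "warping_crossing f E b' p"
    "\<And>q. q \<noteq> p \<Longrightarrow> warping_crossing f E b q \<longleftrightarrow> warping_crossing f E b' q"
proof -
  let ?S = "\<Union>p\<in>crossings f. strands f p"
  \<comment> \<open>The strand to be passed is the over strand: just before it \<open>p\<close> is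
    met first from above, just after it first from below.\<close>
  define z where "z = E p"
  define T where "T = travel_time z ` (?S - {z})"
  note st = strands_eq[OF assms(1,2)]
  have S: "?S \<subseteq> circle" by (auto simp: strands_def)
  have "z \<in> ?S" using st(1)[OF assms(3)] assms(3) by (auto simp: z_def)
  then have z: "norm z = 1" "z \<in> ?S" using S by auto
  have "finite ?S" using assms st by (auto simp: knot_projection_def)
  then have "finite T" by (simp add: T_def)
  have T: "0 < t \<and> t < 2 * pi" if "t \<in> T" for t
    using that travel_time_pos[OF z(1)] travel_time_bounds(2) S by (auto simp: T_def subset_iff)
  \<comment> \<open>Half the smallest arc length from \<open>z\<close> to another strand in either
    direction, capped by \<open>pi / 2\<close>; the entry \<open>pi\<close> also keeps the set
    nonempty when \<open>T\<close> is empty.\<close>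
  define e where "e = Min (insert pi (T \<union> (\<lambda>t. 2 * pi - t) ` T)) / 2"
  have e: "0 < e" "e < pi" "\<And>t. t \<in> T \<Longrightarrow> e < t" "\<And>t. t \<in> T \<Longrightarrow> t + e < 2 * pi"
  proof -
    let ?M = "insert pi (T \<union> (\<lambda>t. 2 * pi - t) ` T)"
    have fin: "finite ?M" using \<open>finite T\<close> by simp
    have "Min ?M \<in> ?M" using fin by (intro Min_in) auto
    then have pos: "0 < Min ?M" using T by auto
    then show "0 < e" by (simp add: e_def)
    have le: "2 * e \<le> m" if "m \<in> ?M" for m
      using Min_le[OF fin that] by (simp add: e_def)
    show "e < pi" using le[of pi] \<open>0 < e\<close> by simp
    show "e < t" if "t \<in> T" for t using le[of t] that \<open>0 < e\<close> by simp
    show "t + e < 2 * pi" if "t \<in> T" for t using le[of "2 * pi - t"] that \<open>0 < e\<close> by simp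
  qed
  define b where "b = z * cis (- e)"
  define b' where "b' = z * cis e"
  have n: "norm b = 1" "norm b' = 1" using z by (simp_all add: b_def b'_def norm_mult)
  have bz: "travel_time b z = e"
    using e n by (intro travel_time_eqI) (auto simp: b_def mult.assoc cis_mult)
  have b'z: "travel_time b' z = 2 * pi - e"
    using e n by (intro travel_time_eqI) (auto simp: b'_def mult.assoc cis_mult)
  \<comment> \<open>The bounds on \<open>e\<close> keep the shifted times inside
    \<open>[0, 2 pi)\<close>, so no wrap-around occurs.\<close>
  have tb: "travel_time b w = travel_time z w + e"
    and tb': "travel_time b' w = travel_time z w - e" if "w \<in> ?S" "w \<noteq> z" for w
  proof -
    have w: "travel_time z w \<in> T" using that by (auto simp: T_def)
    have "norm w = 1" using that S by auto
    then have c: "z * cis (travel_time z w) = w" by (rule cis_travel_time[OF z(1)])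
    show "travel_time b w = travel_time z w + e"
      using e w n T[OF w] c by (intro travel_time_eqI) (auto simp: b_def mult.assoc cis_mult)
    show "travel_time b' w = travel_time z w - e"
      using e(3)[OF w] e(1) w n T[OF w] c
      by (intro travel_time_eqI) (auto simp: b'_def mult.assoc cis_mult)
  qed
  \<comment> \<open>A point is at travel time 0 from itself, so a base point that was a strand would
    be at time 0 from some strand.\<close>
  have off: "x \<in> circle - ?S" if "norm x = 1" "\<And>w. w \<in> ?S \<Longrightarrow> travel_time x w \<noteq> 0" for x
  proof -
    have "travel_time x x = 0" using that(1) by (intro travel_time_eqI) auto
    then show ?thesis using that by auto
  qed
  show thesis
  proof (rule that)
    show "b \<in> circle - ?S"
    proof (rule off[OF n(1)])
      fix w assume "w \<in> ?S"
      then show "travel_time b w \<noteq> 0"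
        using tb[of w] bz e(1) travel_time_bounds(1)[of z w] by (cases "w = z") auto
    qed
    show "b' \<in> circle - ?S"
    proof (rule off[OF n(2)])
      fix w assume w: "w \<in> ?S"
      show "travel_time b' w \<noteq> 0"
      proof (cases "w = z")
        case False
        then have "travel_time z w \<in> T" using w by (auto simp: T_def)
        then show ?thesis using tb'[OF w False] e(3) by force
      qed (use b'z e in auto)
    qed
    define u where "u = under_strand f E p"
    have u: "u \<in> ?S" "u \<noteq> z" using st[OF assms(3)] assms(3) by (auto simp: u_def z_def)
    then have uT: "travel_time z u \<in> T" by (auto simp: T_def)
    show "\<not> warping_crossing f E b p"
      using tb[OF u] bz T[OF uT] by (simp add: warping_crossing_def flip: u_def z_def)
    show "warping_crossing f E b' p"
      using tb'[OF u] b'z T[OF uT] assms(3) by (simp add: warping_crossing_def flip: u_def z_def)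
    fix q assume "q \<noteq> p"
    show "warping_crossing f E b q \<longleftrightarrow> warping_crossing f E b' q"
    proof (cases "q \<in> crossings f")
      case True
      \<comment> \<open>The value of \<open>f\<close> at \<open>z\<close> is \<open>p\<close>, so
        \<open>z\<close> is a strand of no other crossing.\<close>
      have "z \<notin> strands f q"
        using \<open>q \<noteq> p\<close> st(1)[OF assms(3)] by (auto simp: strands_def z_def set_eq_iff)
      then have "E q \<in> ?S" "E q \<noteq> z" "under_strand f E q \<in> ?S" "under_strand f E q \<noteq> z"
        using st(1)[OF True] True by auto
      then show ?thesis by (simp add: warping_crossing_def tb tb')
    qed (simp add: warping_crossing_def)
  qed
qed

text \<open>Carries warping information from an arbitrary point off the strands to a column of the
  matrix: the component of \<open>b\<close> is an edge, hence contains a listed base point.\<close>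

lemma base_point_on_edge:
  assumes "knot_projection f" "E \<in> diagrams f" "base_points f bs"
    and b: "b \<in> circle - (\<Union>p\<in>crossings f. strands f p)"
  obtains j where "j < 2 * card (crossings f)"
    "\<And>q. warping_crossing f E (bs ! j) q \<longleftrightarrow> warping_crossing f E b q"
proof -
  let ?X = "circle - (\<Union>p\<in>crossings f. strands f p)"
  let ?C = "connected_component_set ?X b"
  have C: "?C \<in> edges f" unfolding edges_def components_def using b by (rule imageI)
  have "\<forall>e\<in>edges f. \<exists>!j. j < length bs \<and> bs ! j \<in> e"
    using assms(3) unfolding base_points_def by (elim conjE)
  then have "\<exists>!j. j < length bs \<and> bs ! j \<in> ?C" using C by (rule bspec)
  then obtain j where j: "j < length bs" "bs ! j \<in> ?C" by (elim ex1E conjE)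
  have "b \<in> ?C" using b by (simp only: mem_Collect_eq connected_component_refl)
  then have same: "warping_crossing f E (bs ! j) q \<longleftrightarrow> warping_crossing f E b q" for q
    by (rule warping_crossing_constant[OF assms(1,2) connected_connected_component
        connected_component_subset j(2)])
  have "length bs = 2 * card (crossings f)"
    using assms(3) unfolding base_points_def by (elim conjE)
  with j(1) same show thesis by (intro that) (simp_all only:)
qed

lemma base_points_in_circle:
  assumes "base_points f bs" "j < 2 * card (crossings f)"
  shows "bs ! j \<in> circle"
proof -
  have "length bs = 2 * card (crossings f)" and sub: "set bs \<subseteq> \<Union>(edges f)"
    using assms(1) unfolding base_points_def by simp_all
  then have "bs ! j \<in> set bs" using assms(2) by (metis nth_mem)
  then have "bs ! j \<in> \<Union>(edges f)" using sub by (rule rev_subsetD)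
  then show ?thesis unfolding edges_def Union_components by (rule DiffD1)
qed

section \<open>Rows of the warping matrix\<close>

text \<open>Ensures that every index into an enumeration of the diagrams is a valid row index of the
  matrix.\<close>

lemma card_diagrams:
  assumes "knot_projection f"
  shows "card (diagrams f) = 2 ^ card (crossings f)"
proof -
  have "card (diagrams f) = (\<Prod>p\<in>crossings f. card (strands f p))"
    using assms unfolding diagrams_def knot_projection_def by (intro card_PiE) blast
  also have "\<dots> = (\<Prod>p\<in>crossings f. 2)"
    using assms unfolding knot_projection_def by (intro prod.cong) blast+
  finally show ?thesis by simp
qed

lemma diagram_row_carrier: "diagram_row f Es bs E \<in> carrier_vec (2 * card (crossings f))"
  unfolding diagram_row_def warping_matrix_def
  by (rule carrier_vecI) (simp only: index_row dim_col_mat)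

lemma diagram_row_index:
  assumes "knot_projection f" "enumerates_diagrams f Es" "E \<in> diagrams f"
    and j: "j < 2 * card (crossings f)"
  shows "diagram_row f Es bs E $ j = real (warping_degree f E (bs ! j))"
proof -
  have len: "length Es = 2 ^ card (crossings f)"
    using assms(2) distinct_card[of Es] card_diagrams[OF assms(1)]
    by (simp add: enumerates_diagrams_def)
  have dist: "distinct Es" using assms(2) by (simp add: enumerates_diagrams_def)
  obtain i where i: "i < length Es" "Es ! i = E"
    using assms(2,3) by (metis enumerates_diagrams_def in_set_conv_nth)
  have "(THE i. i < length Es \<and> Es ! i = E) = i"
    using i dist nth_eq_iff_index_eq[of Es _ i] by (intro the_equality) blast+
  then show ?thesis using i len j by (simp add: diagram_row_def warping_matrix_def)
qed

section \<open>Vanishing of the coefficients in a linear relation\<close>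

lemma diagram_rows_independent:
  assumes kp: "knot_projection f" and D: "D \<in> diagrams f" and ne: "crossings f \<noteq> {}"
    and bs: "base_points f bs"
    and rel: "\<And>j. j < 2 * card (crossings f) \<Longrightarrow>
      a D * real (warping_degree f D (bs ! j)) +
      (\<Sum>p\<in>crossings f. a (crossing_change f D p) *
         real (warping_degree f (crossing_change f D p) (bs ! j))) = 0"
  shows "a D = 0" "\<And>p. p \<in> crossings f \<Longrightarrow> a (crossing_change f D p) = 0"
proof -
  let ?C = "crossings f"
  define \<alpha> where "\<alpha> p = a (crossing_change f D p)" for p
  define w where "w j p = (of_bool (warping_crossing f D (bs ! j) p) :: real)" for j p
  define A where "A = a D + (\<Sum>p\<in>?C. \<alpha> p)"
  have fin: "finite ?C" using kp by (simp add: knot_projection_def)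
  have main: "(\<Sum>p\<in>?C. (A - 2 * \<alpha> p) * w j p) + (\<Sum>p\<in>?C. \<alpha> p) = 0"
    if j: "j < 2 * card ?C" for j
  proof -
    let ?d = "\<Sum>p\<in>?C. w j p"
    have d: "real (warping_degree f D (bs ! j)) = ?d"
      by (simp add: warping_degree_eq_sum[OF fin] w_def)
    have "a D * ?d + (\<Sum>p\<in>?C. \<alpha> p * (?d + 1 - 2 * w j p)) = 0"
      using rel[OF j]
      by (simp add: warping_degree_crossing_change[OF kp D _ base_points_in_circle[OF bs j]]
          d \<alpha>_def flip: w_def cong: sum.cong_simp)
    moreover have "(\<Sum>p\<in>?C. \<alpha> p * (?d + 1 - 2 * w j p)) =
        (\<Sum>p\<in>?C. \<alpha> p) * ?d + (\<Sum>p\<in>?C. \<alpha> p) - (\<Sum>p\<in>?C. 2 * \<alpha> p * w j p)"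
      by (simp add: algebra_simps sum.distrib sum_subtractf sum_distrib_right)
    moreover have "(\<Sum>p\<in>?C. (A - 2 * \<alpha> p) * w j p) = A * ?d - (\<Sum>p\<in>?C. 2 * \<alpha> p * w j p)"
      by (simp add: left_diff_distrib sum_subtractf sum_distrib_left)
    ultimately show ?thesis by (simp add: A_def algebra_simps)
  qed
  have half: "A = 2 * \<alpha> p" if p: "p \<in> ?C" for p
  proof -
    obtain b b' where b: "b \<in> circle - (\<Union>p\<in>crossings f. strands f p)"
      "b' \<in> circle - (\<Union>p\<in>crossings f. strands f p)"
      "\<not> warping_crossing f D b p" "warping_crossing f D b' p"
      "\<And>q. q \<noteq> p \<Longrightarrow> warping_crossing f D b q \<longleftrightarrow> warping_crossing f D b' q"
      using warping_crossing_jump[OF kp D p] by metis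
    \<comment> \<open>The relation is available only at listed base points, so \<open>b\<close> and
      \<open>b'\<close> are replaced by those on their edges.\<close>
    obtain j where j: "j < 2 * card ?C"
        "\<And>q. warping_crossing f D (bs ! j) q \<longleftrightarrow> warping_crossing f D b q"
      using base_point_on_edge[OF kp D bs b(1)] by metis
    obtain j' where j': "j' < 2 * card ?C"
        "\<And>q. warping_crossing f D (bs ! j') q \<longleftrightarrow> warping_crossing f D b' q"
      using base_point_on_edge[OF kp D bs b(2)] by metis
    have "w j p = 0" "w j' p = 1" using b j j' by (simp_all add: w_def)
    moreover have "(\<Sum>q\<in>?C - {p}. (A - 2 * \<alpha> q) * w j q) = (\<Sum>q\<in>?C - {p}. (A - 2 * \<alpha> q) * w j' q)"
      using b(5) j(2) j'(2) by (intro sum.cong) (auto simp: w_def)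
    \<comment> \<open>Subtracting the relations at \<open>j\<close> and \<open>j'\<close> cancels
      every term except that of \<open>p\<close>, leaving
      \<open>A - 2 * \<alpha> p = 0\<close>.\<close>
    ultimately show ?thesis
      using main[OF j(1)] main[OF j'(1)] by (simp add: sum.remove[OF fin p])
  qed
  \<comment> \<open>Column 0 exists because there is a crossing; in its relation all coefficients of
    \<open>w\<close> are already 0.\<close>
  have "0 < 2 * card ?C" using fin ne by (simp add: card_gt_0_iff)
  moreover have "(\<Sum>p\<in>?C. (A - 2 * \<alpha> p) * w 0 p) = 0"
    by (rule sum.neutral) (use half in auto)
  ultimately have S0: "(\<Sum>p\<in>?C. \<alpha> p) = 0" using main[of 0] by simp
  \<comment> \<open>The sum is also \<open>card ?C * A / 2\<close>, and \<open>card ?C\<close> is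
    nonzero, so \<open>A\<close> vanishes.\<close>
  moreover have "(\<Sum>p\<in>?C. \<alpha> p) = (\<Sum>p\<in>?C. A / 2)"
    by (rule sum.cong) (use half in auto)
  ultimately have A0: "A = 0" using fin ne by simp
  show "a D = 0" using A0 S0 by (simp add: A_def)
  show "a (crossing_change f D p) = 0" if "p \<in> ?C" for p
    using half[OF that] A0 by (simp add: \<alpha>_def)
qed

section \<open>Passage to the indexed list of diagrams\<close>

theorem theorem5p1:
  fixes P :: "complex \<Rightarrow> real ^ 3"
    and D :: crossing_info
    and c :: nat
    and v :: "nat \<Rightarrow> real ^ 3"
    and Es :: "crossing_info list"
    and bs :: "complex list"
  assumes "knot_diagram P D"
    and "c = card (crossings P)" and "c \<ge> 1"
    and "bij_betw v {1..c} (crossings P)"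
    and "enumerates_diagrams P Es"
    and "base_points P bs"
  shows "linearly_independent_diagrams P Es bs
           (D # map (\<lambda>i. crossing_change P D (v i)) [1..<c + 1])"
proof -
  let ?Ds = "D # map (\<lambda>i. crossing_change P D (v i)) [1..<c + 1]"
  let ?cc = "crossing_change P D" and ?C = "crossings P"
  have kp: "knot_projection P" and D: "D \<in> diagrams P"
    using assms(1) by (simp_all add: knot_diagram_def)
  have fin: "finite ?C" using kp by (simp add: knot_projection_def)
  have ne: "?C \<noteq> {}" using assms(2,3) by auto
  have upt: "set [1..<c + 1] = {1..c}" by (auto simp del: upt_Suc)
  have ran: "v ` set [1..<c + 1] = ?C"
    using assms(4) unfolding upt bij_betw_def by blast
  have inj: "inj_on v (set [1..<c + 1])"
    using assms(4) unfolding upt bij_betw_def by blast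
  have set: "set ?Ds = insert D (?cc ` ?C)"
    unfolding ran[symmetric] by (simp add: image_image del: set_upt)
  have D_new: "D \<notin> ?cc ` ?C" using crossing_change_neq[OF kp D] by force
  have inj_cc: "inj_on ?cc ?C" by (rule inj_on_crossing_change[OF kp D])
  have "inj_on (\<lambda>i. ?cc (v i)) (set [1..<c + 1])"
    using comp_inj_on[OF inj, of ?cc] inj_cc unfolding ran by (simp add: comp_def)
  \<comment> \<open>Distinct rows require distinct diagrams in the list as well as injectivity of
    \<open>diagram_row\<close> on them.\<close>
  then have dist: "distinct ?Ds" using D_new ran by (auto simp: distinct_map simp del: set_upt upt_Suc)
  have sub: "set ?Ds \<subseteq> diagrams P"
    unfolding set using D crossing_change_in_diagrams[OF kp D] by auto
  have indep: "\<forall>E\<in>set ?Ds. a E = 0"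
    if a: "\<And>j. j < 2 * card ?C \<Longrightarrow> (\<Sum>E\<in>set ?Ds. a E * diagram_row P Es bs E $ j) = 0"
    for a :: "crossing_info \<Rightarrow> real"
  proof -
    have "a D * real (warping_degree P D (bs ! j)) +
      (\<Sum>p\<in>?C. a (?cc p) * real (warping_degree P (?cc p) (bs ! j))) = 0"
      if j: "j < 2 * card ?C" for j
    proof -
      have "(\<Sum>E\<in>set ?Ds. a E * diagram_row P Es bs E $ j) =
          (\<Sum>E\<in>set ?Ds. a E * real (warping_degree P E (bs ! j)))"
        using sub by (intro sum.cong) (auto simp only: diagram_row_index[OF kp assms(5) _ j] subset_iff)
      also have "\<dots> = a D * real (warping_degree P D (bs ! j)) +
          (\<Sum>p\<in>?C. a (?cc p) * real (warping_degree P (?cc p) (bs ! j)))"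
        unfolding set using fin D_new by (simp add: sum.reindex[OF inj_cc])
      finally show ?thesis using a[OF j] by simp
    qed
    note z = diagram_rows_independent[OF kp D ne assms(6) this]
    show ?thesis unfolding set using z by blast
  qed
  \<comment> \<open>The diagrams themselves serve as the index set of the family of rows.\<close>
  note rows = inj_on_lin_indpt_image[of "set ?Ds" "diagram_row P Es bs" "2 * card ?C",
      OF finite_set diagram_row_carrier]
  have "inj_on (diagram_row P Es bs) (set ?Ds)"
    using indep by (rule rows(1)) blast
  moreover have "LinearCombinations.module.lin_indpt class_ring
      (module_vec TYPE(real) (2 * card ?C)) (diagram_row P Es bs ` set ?Ds)"
    using indep by (rule rows(2)) blast
  ultimately show ?thesis
    unfolding linearly_independent_diagrams_def Let_def set_map distinct_map
    using dist by blast
qed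

end
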